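(* Let $n\ge 1$, $d\ge 0$, and for $1\le k\le 2n+1$ let $p_{d,k}=F_{1,2}\big(x_1^{d}\,s_{n,k}\big)\in \mathrm{S}^{d+k}(E)$. Then, up to an overall sign, the following formulas hold. For $k=1,\dots,n$: $p_{d,k}=x_1^{d}\,\Gamma([k])$. For $k=n+1$: $p_{d,n+1}=x_1^{d}\big(x_{2n+1}\Gamma([n])-\eta_{2n+1}\,\eta([n])\big)$. For $k=n+2,\dots,2n+1$: $$p_{d,k}=x_1^{d}\sum_{a=0}^{k-n-1}b_a\,x_{2n+1}^{2(k-n-a)-1}\Big(\sum_{I}\Gamma\big([2n+1-k]\cup I\cup\underline{I}\big)\Big)-x_1^{d}\sum_{a=0}^{k-n-1}b_{a+1}\,x_{2n+1}^{2(k-n-a)-2}\,\eta_{2n+1}\Big(\sum_{I}\eta\big([2n+1-k]\cup I\cup\underline{I}\big)\Big),$$ where in both inner sums $I$ runs over the subsets of $\{2n-k+2,\dots,n\}$ with $|I|=a$, and $b_0=1$, $b_a=\prod_{r=0}^{a-1}\big(2(k-n-r)-1\big)$.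
   Context: Let $E$ be the super vector space with even basis $x_1,\dots,x_{2n+1}$ and odd basis $\eta_1,\dots,\eta_{2n+1}$, and $\mathrm{S}(E)=\mathbb{C}[x_1,\dots,x_{2n+1}]\otimes\Lambda(\eta_1,\dots,\eta_{2n+1})$, graded by total degree. Let $F_{1,2}$ be the operator $F_{1,2}=\eta_{2n+1}\partial_{x_{2n+1}}-\sum_{i=1}^{2n}x_i\partial_{\eta_i}$ on $\mathrm{S}(E)$ (left derivatives in the odd variables). For $I=\{i_1<\dots<i_a\}\subseteq\{1,\dots,2n\}$ put $|I|=a$, $\eta(I)=\eta_{i_1}\cdots\eta_{i_a}$ (with $\eta(\emptyset)=1$), $\underline{I}=\{2n+1-i: i\in I\}$, and $\Gamma(I)=\sum_{j=1}^{a}(-1)^{j-1}x_{i_j}\,\eta(I\setminus\{i_j\})$ (with $\Gamma(\emptyset)=0$). For $0\le k\le 2n$, $[k]=\{1,\dots,k\}$. For $0\le k\le n$ put $s_{n,k}=\eta([k])$, and for $n+1\le k\le 2n+1$ put $$s_{n,k}=\Delta_k=\sum_{a=0}^{k-n-1}b_a\,x_{2n+1}^{2(k-n-a)-1}\sum_{I\subseteq\{2n-k+2,\dots,n\},\ |I|=a}\eta\big([2n+1-k]\cup I\cup\underline{I}\big),$$ with $b_0=1$, $b_a=\prod_{r=0}^{a-1}(2(k-n-r)-1)$ (depending on $k$). *)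

theory Defs
  imports Complex_Main "HOL-Library.Poly_Mapping"
begin

section \<open>The Grassmann algebra over a commutative ring\<close>

text \<open>
  An element of \<open>'a grassmann\<close> is a finite sum of terms \<open>c\<^sub>J \<cdot> \<eta>\<^sub>J\<close>, where \<open>J\<close> is a finite
  set of natural numbers and \<open>\<eta>\<^sub>J\<close> is the product of the \<open>\<eta>\<^sub>j\<close>, \<open>j \<in> J\<close>, in increasing order.
  It is represented by its coefficient function \<open>J \<mapsto> c\<^sub>J\<close>.
\<close>

typedef (overloaded) 'a grassmann =
  "{f :: nat set \<Rightarrow> 'a::zero. finite {J. f J \<noteq> 0} \<and> (\<forall>J. infinite J \<longrightarrow> f J = 0)}"
  morphisms gcoeff Abs_grassmann
  by (rule exI[of _ "\<lambda>_. 0"]) simp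

setup_lifting type_definition_grassmann

lemma gcoeff_infinite: "infinite J \<Longrightarrow> gcoeff f J = 0"
  by transfer auto

lemma finite_gcoeff: "finite {J. gcoeff f J \<noteq> 0}"
  by transfer auto

lemma grassmann_eqI: "(\<And>J. finite J \<Longrightarrow> gcoeff f J = gcoeff g J) \<Longrightarrow> f = g"
  by (metis gcoeff_infinite gcoeff_inject ext)

text \<open>
  For disjoint \<open>A\<close>, \<open>B\<close> one has \<open>\<eta>\<^sub>A \<cdot> \<eta>\<^sub>B = (-1)\<^sup>N \<cdot> \<eta>\<^sub>A\<^sub>\<union>\<^sub>B\<close>, where \<open>N = inversions A B\<close>
  counts the transpositions needed to sort the concatenated product.
\<close>

definition inversions :: "nat set \<Rightarrow> nat set \<Rightarrow> nat" where
  "inversions A B = card {(a, b). a \<in> A \<and> b \<in> B \<and> b < a}"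

lemma finite_inversions:
  "finite A \<Longrightarrow> finite B \<Longrightarrow> finite {(a, b). a \<in> A \<and> b \<in> B \<and> b < (a::nat)}"
  by (rule finite_subset[of _ "A \<times> B"]) auto

lemma inversions_Un_left:
  assumes "finite A" "finite B" "finite C" "A \<inter> B = {}"
  shows "inversions (A \<union> B) C = inversions A C + inversions B C"
proof -
  have "{(a, b). a \<in> A \<union> B \<and> b \<in> C \<and> b < a} =
      {(a, b). a \<in> A \<and> b \<in> C \<and> b < a} \<union> {(a, b). a \<in> B \<and> b \<in> C \<and> b < a}"
    by auto
  then show ?thesis
    unfolding inversions_def using assms
    by (simp, subst card_Un_disjoint) (auto intro!: finite_inversions)
qed

lemma inversions_Un_right:
  assumes "finite A" "finite B" "finite C" "B \<inter> C = {}"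
  shows "inversions A (B \<union> C) = inversions A B + inversions A C"
proof -
  have "{(a, b). a \<in> A \<and> b \<in> B \<union> C \<and> b < a} =
      {(a, b). a \<in> A \<and> b \<in> B \<and> b < a} \<union> {(a, b). a \<in> A \<and> b \<in> C \<and> b < a}"
    by auto
  then show ?thesis
    unfolding inversions_def using assms
    by (simp, subst card_Un_disjoint) (auto intro!: finite_inversions)
qed

lemma inversions_empty [simp]: "inversions {} B = 0" "inversions A {} = 0"
  by (simp_all add: inversions_def)

instantiation grassmann :: (comm_ring_1) ring_1
begin

lift_definition zero_grassmann :: "'a grassmann" is "\<lambda>_. 0"
  by simp

lift_definition one_grassmann :: "'a grassmann" is "\<lambda>J. if J = {} then 1 else 0"
  by (auto intro: finite_subset[of _ "{{}}"])

lift_definition plus_grassmann :: "'a grassmann \<Rightarrow> 'a grassmann \<Rightarrow> 'a grassmann"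
  is "\<lambda>f g J. f J + g J"
proof -
  fix f g :: "nat set \<Rightarrow> 'a"
  assume "finite {J. f J \<noteq> 0} \<and> (\<forall>J. infinite J \<longrightarrow> f J = 0)"
    "finite {J. g J \<noteq> 0} \<and> (\<forall>J. infinite J \<longrightarrow> g J = 0)"
  then show "finite {J. f J + g J \<noteq> 0} \<and> (\<forall>J. infinite J \<longrightarrow> f J + g J = 0)"
    by (auto intro: finite_subset[of _ "{J. f J \<noteq> 0} \<union> {J. g J \<noteq> 0}"])
qed

lift_definition uminus_grassmann :: "'a grassmann \<Rightarrow> 'a grassmann"
  is "\<lambda>f J. - f J"
  by simp

lift_definition minus_grassmann :: "'a grassmann \<Rightarrow> 'a grassmann \<Rightarrow> 'a grassmann"
  is "\<lambda>f g J. f J - g J"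
proof -
  fix f g :: "nat set \<Rightarrow> 'a"
  assume "finite {J. f J \<noteq> 0} \<and> (\<forall>J. infinite J \<longrightarrow> f J = 0)"
    "finite {J. g J \<noteq> 0} \<and> (\<forall>J. infinite J \<longrightarrow> g J = 0)"
  then show "finite {J. f J - g J \<noteq> 0} \<and> (\<forall>J. infinite J \<longrightarrow> f J - g J = 0)"
    by (auto intro: finite_subset[of _ "{J. f J \<noteq> 0} \<union> {J. g J \<noteq> 0}"])
qed

lift_definition times_grassmann :: "'a grassmann \<Rightarrow> 'a grassmann \<Rightarrow> 'a grassmann"
  is "\<lambda>f g J. \<Sum>A\<in>Pow J. (-1) ^ inversions A (J - A) * f A * g (J - A)"
proof -
  fix f g :: "nat set \<Rightarrow> 'a"
  assume f: "finite {J. f J \<noteq> 0} \<and> (\<forall>J. infinite J \<longrightarrow> f J = 0)"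
    and g: "finite {J. g J \<noteq> 0} \<and> (\<forall>J. infinite J \<longrightarrow> g J = 0)"
  let ?h = "\<lambda>J. \<Sum>A\<in>Pow J. (-1) ^ inversions A (J - A) * f A * g (J - A)"
  have "{J. ?h J \<noteq> 0} \<subseteq> (\<lambda>(A, B). A \<union> B) ` ({J. f J \<noteq> 0} \<times> {J. g J \<noteq> 0})"
  proof
    fix J assume "J \<in> {J. ?h J \<noteq> 0}"
    then obtain A where "A \<subseteq> J" "(-1) ^ inversions A (J - A) * f A * g (J - A) \<noteq> 0"
      by (metis (mono_tags, lifting) PowD mem_Collect_eq sum.not_neutral_contains_not_neutral)
    then have "A \<subseteq> J" "f A \<noteq> 0" "g (J - A) \<noteq> 0" by auto
    then show "J \<in> (\<lambda>(A, B). A \<union> B) ` ({J. f J \<noteq> 0} \<times> {J. g J \<noteq> 0})"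
      by (intro image_eqI[of _ _ "(A, J - A)"]) auto
  qed
  moreover have "finite ((\<lambda>(A, B). A \<union> B) ` ({J. f J \<noteq> 0} \<times> {J. g J \<noteq> 0}))"
    using f g by simp
  ultimately show "finite {J. ?h J \<noteq> 0} \<and> (\<forall>J. infinite J \<longrightarrow> ?h J = 0)"
    using finite_subset by (auto simp: finite_Pow_iff)
qed

instance
proof
  fix f g h :: "'a grassmann"
  show "f + g + h = f + (g + h)" by transfer (simp add: add.assoc)
  show "f + g = g + f" by transfer (simp add: add.commute)
  show "0 + f = f" by transfer simp
  show "- f + f = 0" by transfer simp
  show "f - g = f + - g" by transfer simp
  show "(0::'a grassmann) \<noteq> 1" by transfer (metis zero_neq_one)
  show "(f + g) * h = f * h + g * h"
    by transfer (simp add: algebra_simps sum.distrib)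
  show "f * (g + h) = f * g + f * h"
    by transfer (simp add: algebra_simps sum.distrib)
  show "1 * f = f"
  proof (rule grassmann_eqI)
    fix J :: "nat set" assume J: "finite J"
    have "gcoeff (1 * f) J =
        (\<Sum>A\<in>Pow J. if A = {} then gcoeff f J else 0)"
      by transfer (auto intro!: sum.cong)
    then show "gcoeff (1 * f) J = gcoeff f J" using J by (simp add: sum.delta)
  qed
  show "f * 1 = f"
  proof (rule grassmann_eqI)
    fix J :: "nat set" assume J: "finite J"
    have "gcoeff (f * 1) J =
        (\<Sum>A\<in>Pow J. if A = J then gcoeff f J else 0)"
      by transfer (auto intro!: sum.cong)
    then show "gcoeff (f * 1) J = gcoeff f J" using J by (simp add: sum.delta)
  qed
  show "f * g * h = f * (g * h)"
  proof (rule grassmann_eqI)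
    fix J :: "nat set" assume J: "finite J"
    let ?f = "gcoeff f" and ?g = "gcoeff g" and ?h = "gcoeff h"
    let ?u = "\<lambda>A B C. (-1) ^ (inversions A B + inversions A C + inversions B C) *
        ?f A * ?g B * ?h C"
    have fin: "finite A" if "A \<subseteq> J" for A
      using that J finite_subset by blast
    have "gcoeff (f * g * h) J = (\<Sum>C\<in>Pow J. (-1) ^ inversions C (J - C) *
        (\<Sum>A\<in>Pow C. (-1) ^ inversions A (C - A) * ?f A * ?g (C - A)) * ?h (J - C))"
      by transfer simp
    also have "\<dots> = (\<Sum>C\<in>Pow J. \<Sum>A\<in>Pow C. ?u A (C - A) (J - C))"
    proof (intro sum.cong refl)
      fix C assume C: "C \<in> Pow J"
      have "inversions C (J - C) = inversions A (J - C) + inversions (C - A) (J - C)"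
        if "A \<subseteq> C" for A
        using inversions_Un_left[of A "C - A" "J - C"] that C fin[of A] fin[of "C - A"] J
        by (auto simp: Un_absorb1)
      then show "(-1) ^ inversions C (J - C) *
          (\<Sum>A\<in>Pow C. (-1) ^ inversions A (C - A) * ?f A * ?g (C - A)) * ?h (J - C) =
          (\<Sum>A\<in>Pow C. ?u A (C - A) (J - C))"
        by (auto simp: sum_distrib_left sum_distrib_right power_add mult_ac intro!: sum.cong)
    qed
    also have "\<dots> = (\<Sum>(C, A)\<in>Sigma (Pow J) Pow. ?u A (C - A) (J - C))"
      using J fin by (subst sum.Sigma) auto
    also have "\<dots> = (\<Sum>(A, B)\<in>Sigma (Pow J) (\<lambda>A. Pow (J - A)). ?u A B (J - A - B))"
      by (rule sum.reindex_bij_witness[of _ "\<lambda>(A, B). (A \<union> B, A)" "\<lambda>(C, A). (A, C - A)"])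
        (auto intro!: arg_cong[of _ _ gcoeff] simp: Un_absorb1 Diff_Un[symmetric] Diff_eq Int_Un_distrib
          Int_absorb1 Int_absorb2 ac_simps intro: arg_cong2)
    also have "\<dots> = (\<Sum>A\<in>Pow J. \<Sum>B\<in>Pow (J - A). ?u A B (J - A - B))"
      using J fin by (subst sum.Sigma) auto
    also have "\<dots> = (\<Sum>A\<in>Pow J. (-1) ^ inversions A (J - A) * ?f A *
        (\<Sum>B\<in>Pow (J - A). (-1) ^ inversions B (J - A - B) * ?g B * ?h (J - A - B)))"
    proof (intro sum.cong refl)
      fix A assume A: "A \<in> Pow J"
      have "inversions A (J - A) = inversions A B + inversions A (J - A - B)"
        if "B \<subseteq> J - A" for B
      proof -
        have "J - A = B \<union> (J - A - B)" using that by auto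
        then show ?thesis
          using inversions_Un_right[of A B "J - A - B"] that A fin[of A] fin[of B] J
          by (metis Diff_disjoint Diff_subset PowD finite_Diff order_trans)
      qed
      then show "(\<Sum>B\<in>Pow (J - A). ?u A B (J - A - B)) = (-1) ^ inversions A (J - A) * ?f A *
          (\<Sum>B\<in>Pow (J - A). (-1) ^ inversions B (J - A - B) * ?g B * ?h (J - A - B))"
        by (auto simp: sum_distrib_left power_add mult_ac intro!: sum.cong)
    qed
    also have "\<dots> = gcoeff (f * (g * h)) J"
      by transfer simp
    finally show "gcoeff (f * g * h) J = gcoeff (f * (g * h)) J" .
  qed
qed

end

lift_definition gconst :: "'a::zero \<Rightarrow> 'a grassmann" is "\<lambda>c J. if J = {} then c else 0"
  by (auto intro: finite_subset[of _ "{{}}"])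

lift_definition eta :: "nat \<Rightarrow> 'a::zero_neq_one grassmann" is "\<lambda>i J. if J = {i} then 1 else 0"
  by (auto intro: finite_subset[of _ "{{i}}" for i])

text \<open>
  The left derivative by \<open>\<eta>\<^sub>i\<close> sends \<open>\<eta>\<^sub>J\<close> to \<open>(-1)\<^sup>N \<cdot> \<eta>\<^sub>K\<close> with \<open>K = J - {i}\<close> and \<open>N\<close> the number
  of \<open>j \<in> J\<close> with \<open>j < i\<close> if \<open>i \<in> J\<close>, and to \<open>0\<close> otherwise. Below, this is read
  off on coefficients.
\<close>

lift_definition deriv_eta :: "nat \<Rightarrow> 'a::comm_ring_1 grassmann \<Rightarrow> 'a grassmann"
  is "\<lambda>i f J. if i \<in> J then 0 else (-1) ^ card {j \<in> J. j < i} * f (insert i J)"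
proof -
  fix i :: nat and f :: "nat set \<Rightarrow> 'a"
  assume f: "finite {J. f J \<noteq> 0} \<and> (\<forall>J. infinite J \<longrightarrow> f J = 0)"
  let ?h = "\<lambda>J. if i \<in> J then 0 else (-1) ^ card {j \<in> J. j < i} * f (insert i J)"
  have "{J. ?h J \<noteq> 0} \<subseteq> (\<lambda>J. J - {i}) ` {J. f J \<noteq> 0}"
  proof
    fix J assume "J \<in> {J. ?h J \<noteq> 0}"
    then have "i \<notin> J" "f (insert i J) \<noteq> 0" by (auto split: if_splits)
    then show "J \<in> (\<lambda>J. J - {i}) ` {J. f J \<noteq> 0}"
      by (intro image_eqI[of _ _ "insert i J"]) auto
  qed
  then have "finite {J. ?h J \<noteq> 0}"
    using f finite_surj by blast
  moreover have "\<forall>J. infinite J \<longrightarrow> ?h J = 0"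
    using f by auto
  ultimately show "finite {J. ?h J \<noteq> 0} \<and> (\<forall>J. infinite J \<longrightarrow> ?h J = 0)"
    by blast
qed


section \<open>The super symmetric algebra\<close>

text \<open>
  Polynomials are finitely supported maps from exponent vectors to coefficients, with the
  convolution product. The type \<open>super_poly\<close> has variables \<open>x\<^sub>i\<close>, \<open>\<eta>\<^sub>i\<close> for
  all natural numbers \<open>i\<close>; the algebra \<open>S(E)\<close> is the subalgebra generated by those
  with \<open>1 \<le> i \<le> 2n+1\<close>, and its homogeneous components are the sets \<open>S_homog n m\<close> below.
\<close>

type_synonym cpoly = "(nat \<Rightarrow>\<^sub>0 nat) \<Rightarrow>\<^sub>0 complex"

type_synonym super_poly = "cpoly grassmann"

definition X :: "nat \<Rightarrow> super_poly" where
  "X i = gconst (Poly_Mapping.single (Poly_Mapping.single i 1) 1)"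

text \<open>
  If \<open>x\<^sub>i\<close> does not occur in the monomial \<open>x\<^sup>m\<close>, the truncated subtraction is harmless, as the
  coefficient vanishes.
\<close>

definition poly_deriv :: "nat \<Rightarrow> cpoly \<Rightarrow> cpoly" where
  "poly_deriv i p = (\<Sum>m\<in>Poly_Mapping.keys p.
     Poly_Mapping.single (m - Poly_Mapping.single i 1)
       (of_nat (Poly_Mapping.lookup m i) * Poly_Mapping.lookup p m))"

lift_definition deriv_x :: "nat \<Rightarrow> super_poly \<Rightarrow> super_poly"
  is "\<lambda>i f J. poly_deriv i (f J)"
proof -
  fix i :: nat and f :: "nat set \<Rightarrow> cpoly"
  have "poly_deriv i 0 = 0" by (simp add: poly_deriv_def)
  moreover assume "finite {J. f J \<noteq> 0} \<and> (\<forall>J. infinite J \<longrightarrow> f J = 0)"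
  ultimately show "finite {J. poly_deriv i (f J) \<noteq> 0} \<and>
      (\<forall>J. infinite J \<longrightarrow> poly_deriv i (f J) = 0)"
    by (auto intro: finite_subset[of _ "{J. f J \<noteq> 0}"])
qed

definition S_homog :: "nat \<Rightarrow> nat \<Rightarrow> super_poly set" where
  "S_homog n m = {f. \<forall>J. \<forall>e\<in>Poly_Mapping.keys (gcoeff f J).
     J \<subseteq> {1..2*n+1} \<and> Poly_Mapping.keys e \<subseteq> {1..2*n+1} \<and>
     (\<Sum>i\<in>{1..2*n+1}. Poly_Mapping.lookup e i) + card J = m}"

definition F12 :: "nat \<Rightarrow> super_poly \<Rightarrow> super_poly" where
  "F12 n f = eta (2*n+1) * deriv_x (2*n+1) f - (\<Sum>i\<in>{1..2*n}. X i * deriv_eta i f)"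

definition eta_prod :: "nat set \<Rightarrow> super_poly" where
  "eta_prod I = prod_list (map eta (sorted_list_of_set I))"

definition mirror :: "nat \<Rightarrow> nat set \<Rightarrow> nat set" where
  "mirror n I = (\<lambda>i. 2*n+1 - i) ` I"

text \<open>The index \<open>j\<close> starts at \<open>0\<close>, so the sign is \<open>(-1)\<^sup>j\<close>.\<close>

definition Gamma :: "nat set \<Rightarrow> super_poly" where
  "Gamma I = (\<Sum>j<card I. (-1) ^ j * X (sorted_list_of_set I ! j) *
     eta_prod (I - {sorted_list_of_set I ! j}))"

definition b_coeff :: "nat \<Rightarrow> nat \<Rightarrow> nat \<Rightarrow> int" where
  "b_coeff n k a = (\<Prod>r<a. 2 * (int k - int n - int r) - 1)"

text \<open>
  The subsets \<open>I\<close> of \<open>{2n-k+2,\<dots>,n}\<close> of cardinality \<open>a\<close>. For \<open>k = 2n+1\<close> the lower bound is \<open>1\<close>;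
  the order of operations avoids truncated subtraction.
\<close>

definition index_sets :: "nat \<Rightarrow> nat \<Rightarrow> nat \<Rightarrow> nat set set" where
  "index_sets n k a = {I. I \<subseteq> {2*n+2-k..n} \<and> card I = a}"

definition Delta :: "nat \<Rightarrow> nat \<Rightarrow> super_poly" where
  "Delta n k = (\<Sum>a=0..k-n-1. of_int (b_coeff n k a) * X (2*n+1) ^ (2*(k-n-a)-1) *
     (\<Sum>I\<in>index_sets n k a. eta_prod ({1..2*n+1-k} \<union> I \<union> mirror n I)))"

definition s_elem :: "nat \<Rightarrow> nat \<Rightarrow> super_poly" where
  "s_elem n k = (if k \<le> n then eta_prod {1..k} else Delta n k)"

definition p_elem :: "nat \<Rightarrow> nat \<Rightarrow> nat \<Rightarrow> super_poly" where
  "p_elem n d k = F12 n (X 1 ^ d * s_elem n k)"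


section \<open>Relations and product rules\<close>

text \<open>
  The generators satisfy the super-commutation relations, \<open>deriv_x i\<close> is an even derivation, and
  \<open>deriv_eta i\<close> is linear over \<open>\<complex>[x]\<close> and an odd derivation acting from the left.
\<close>

lemma gcoeff_times: "gcoeff (f * g) J =
    (\<Sum>A\<in>Pow J. (-1) ^ inversions A (J - A) * gcoeff f A * gcoeff g (J - A))"
  by transfer simp

lemma gcoeff_eta_times: "gcoeff (eta i * f) J =
    (if i \<in> J then (-1) ^ card {j \<in> J. j < i} * gcoeff f (J - {i}) else 0)"
proof (cases "finite J")
  case True
  have inv: "inversions {i} (J - {i}) = card {j \<in> J. j < i}"
    unfolding inversions_def
    by (rule bij_betw_same_card[of snd]) (auto simp: bij_betw_def inj_on_def image_iff)
  have "gcoeff (eta i * f) J = (\<Sum>A\<in>Pow J. if A = {i} then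
      (-1) ^ inversions {i} (J - {i}) * gcoeff f (J - {i}) else 0)"
    unfolding gcoeff_times by (intro sum.cong refl) (auto simp: eta.rep_eq)
  then show ?thesis using True by (simp add: sum.delta' inv)
next
  case False
  then show ?thesis by (simp add: gcoeff_infinite)
qed

lemma gcoeff_gconst_times: "gcoeff (gconst c * f) J = c * gcoeff f J"
proof (cases "finite J")
  case True
  have "gcoeff (gconst c * f) J = (\<Sum>A\<in>Pow J. if A = {} then c * gcoeff f J else 0)"
    unfolding gcoeff_times by (intro sum.cong refl) (auto simp: gconst.rep_eq)
  then show ?thesis using True by (simp add: sum.delta)
next
  case False
  then show ?thesis by (simp add: gcoeff_infinite)
qed

lemma gconst_central: "gconst c * f = f * gconst c"
proof (rule grassmann_eqI)
  fix J :: "nat set" assume "finite J"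
  have "gcoeff (f * gconst c) J = (\<Sum>A\<in>Pow J. if A = J then gcoeff f J * c else 0)"
    unfolding gcoeff_times by (intro sum.cong refl) (auto simp: gconst.rep_eq)
  then show "gcoeff (gconst c * f) J = gcoeff (f * gconst c) J"
    using \<open>finite J\<close> by (simp add: sum.delta gcoeff_gconst_times mult.commute)
qed

lemma deriv_eta_eta_times:
  "deriv_eta i (eta j * f) = (if i = j then f else 0) - eta j * deriv_eta i f"
proof (rule grassmann_eqI)
  fix J :: "nat set" assume J: "finite J"
  have c: "card {k \<in> insert a J. k < b} = card {k \<in> J. k < b} + (if a < b then 1 else 0)" if "a \<notin> J" for a b
  proof -
    have "{k \<in> insert a J. k < b} = (if a < b then insert a {k \<in> J. k < b} else {k \<in> J. k < b})"
      by auto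
    then show ?thesis using that J by simp
  qed
  have c': "card {k \<in> J. k < b} = card {k \<in> J - {a}. k < b} + (if a < b then 1 else 0)" if "a \<in> J" for a b
  proof -
    have "{k \<in> J. k < b} = (if a < b then insert a {k \<in> J - {a}. k < b} else {k \<in> J - {a}. k < b})"
      using that by auto
    then show ?thesis using J by simp
  qed
  have sq: "(-1) ^ m * ((-1) ^ m * x) = (x :: 'a)" for m x
    by (simp add: mult.assoc[symmetric] power_add[symmetric])
  note [simp] = deriv_eta.rep_eq uminus_grassmann.rep_eq minus_grassmann.rep_eq zero_grassmann.rep_eq gcoeff_eta_times
  show "gcoeff (deriv_eta i (eta j * f)) J =
      gcoeff ((if i = j then f else 0) - eta j * deriv_eta i f) J"
  proof (cases "i = j")
    case True
    show ?thesis
    proof (cases "i \<in> J")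
      case 1: True
      then show ?thesis using True c'[of i i] by (simp add: sq insert_absorb)
    next
      case 2: False
      then have "insert i J - {i} = J" by auto
      then show ?thesis using True 2 c[of i i] by (simp add: sq del: insert_Diff_single)
    qed
  next
    case False
    show ?thesis
    proof (cases "i \<notin> J \<and> j \<in> J")
      case 1: True
      then have "insert i J - {j} = insert i (J - {j})" using False by auto
      then show ?thesis using False 1 c[of i j] c'[of j i]
        by (cases i j rule: linorder_cases) (simp_all add: power_add mult_ac)
    next
      case 2: False
      then show ?thesis using False by auto
    qed
  qed
qed

lemma deriv_eta_gconst_times: "deriv_eta i (gconst c * f) = gconst c * deriv_eta i f"
  by (rule grassmann_eqI) (simp add: deriv_eta.rep_eq gcoeff_gconst_times)

lemma deriv_eta_add: "deriv_eta i (f + g) = deriv_eta i f + deriv_eta i g"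
  by (rule grassmann_eqI) (simp add: deriv_eta.rep_eq plus_grassmann.rep_eq algebra_simps)

lemma deriv_eta_1 [simp]: "deriv_eta i 1 = 0"
  by (rule grassmann_eqI) (simp add: deriv_eta.rep_eq one_grassmann.rep_eq zero_grassmann.rep_eq)

lemma eta_anticomm: "eta i * eta j = - (eta j * (eta i :: 'a::comm_ring_1 grassmann))"
proof (rule grassmann_eqI)
  fix J :: "nat set" assume "finite J"
  have 1: "{k. (k = i \<or> k = j) \<and> k < l} = (if i < l then {i} else {}) \<union> (if j < l then {j} else {})" for l
    by auto
  show "gcoeff (eta i * eta j) J = gcoeff (- (eta j * (eta i::'a grassmann))) J"
  proof (cases "J = {i, j} \<and> i \<noteq> j")
    case True
    then show ?thesis
      by (cases i j rule: linorder_cases)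
        (auto simp: uminus_grassmann.rep_eq gcoeff_eta_times eta.rep_eq 1 insert_Diff_if)
  next
    case False
    have "(i \<in> J \<and> J - {i} = {j}) = (J = {i,j} \<and> i \<noteq> j)" "(j \<in> J \<and> J - {j} = {i}) = (J = {i,j} \<and> i \<noteq> j)" by auto
    with False show ?thesis
      by (auto simp: uminus_grassmann.rep_eq gcoeff_eta_times eta.rep_eq)
  qed
qed

lemma eta_square [simp]: "eta i * eta i = 0"
  by (rule grassmann_eqI) (auto simp: gcoeff_eta_times eta.rep_eq zero_grassmann.rep_eq)

lemma poly_deriv_superset:
  "finite M \<Longrightarrow> Poly_Mapping.keys p \<subseteq> M \<Longrightarrow> poly_deriv i p = (\<Sum>m\<in>M.
     Poly_Mapping.single (m - Poly_Mapping.single i 1)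
       (of_nat (Poly_Mapping.lookup m i) * Poly_Mapping.lookup p m))"
  unfolding poly_deriv_def by (rule sum.mono_neutral_left) (auto simp: in_keys_iff)

lemma poly_deriv_single: "poly_deriv i (Poly_Mapping.single m c) =
    Poly_Mapping.single (m - Poly_Mapping.single i 1) (of_nat (Poly_Mapping.lookup m i) * c)"
  by (subst poly_deriv_superset[of "{m}"]) auto

lemma poly_deriv_add: "poly_deriv i (p + q) = poly_deriv i p + poly_deriv i q"
proof -
  let ?M = "Poly_Mapping.keys p \<union> Poly_Mapping.keys q"
  show ?thesis
    using keys_add[of p q]
    by (simp add: poly_deriv_superset[of ?M] lookup_add distrib_left single_add sum.distrib)
qed

lemma poly_deriv_0 [simp]: "poly_deriv i 0 = 0" by (simp add: poly_deriv_def)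

lemma poly_mapping_single_induct [case_names zero add]:
  assumes "P (0 :: 'a \<Rightarrow>\<^sub>0 'b::ab_group_add)" "\<And>m c p. P p \<Longrightarrow> P (Poly_Mapping.single m c + p)"
  shows "P p"
proof -
  have "P p" if "card (Poly_Mapping.keys p) = n" for n p using that
  proof (induction n arbitrary: p)
    case 0 then show ?case using assms(1) by simp
  next
    case (Suc n)
    then obtain m where m: "m \<in> Poly_Mapping.keys p" by (metis card.empty ex_in_conv nat.distinct(1))
    let ?q = "p - Poly_Mapping.single m (Poly_Mapping.lookup p m)"
    have "Poly_Mapping.keys ?q = Poly_Mapping.keys p - {m}"
      by (auto simp: in_keys_iff lookup_minus lookup_single when_def split: if_splits)
    then have "P ?q" using Suc m by simp
    then have "P (Poly_Mapping.single m (Poly_Mapping.lookup p m) + ?q)" by (rule assms(2))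
    then show ?case by simp
  qed
  then show ?thesis by blast
qed

lemma single_deriv_aux:
  fixes m l :: "nat \<Rightarrow>\<^sub>0 nat"
  shows "Poly_Mapping.single (m - Poly_Mapping.single i 1 + l) (of_nat (Poly_Mapping.lookup m i) * c) =
   Poly_Mapping.single (m + l - Poly_Mapping.single i 1) (of_nat (Poly_Mapping.lookup m i) * (c::complex))"
proof (cases "Poly_Mapping.lookup m i = 0")
  case False
  have "m - Poly_Mapping.single i 1 + l = m + l - Poly_Mapping.single i 1"
    using False by (intro poly_mapping_eqI) (auto simp: lookup_add lookup_minus lookup_single when_def)
  then show ?thesis by simp
qed simp

lemma poly_deriv_mult: "poly_deriv i (p * q) = poly_deriv i p * q + p * poly_deriv i q"
proof (induction p rule: poly_mapping_single_induct)
  case (add m c p)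
  have "poly_deriv i (Poly_Mapping.single m c * q) =
     poly_deriv i (Poly_Mapping.single m c) * q + Poly_Mapping.single m c * poly_deriv i q"
  proof (induction q rule: poly_mapping_single_induct)
    case (add l d q)
    show ?case
      using single_deriv_aux[of m i l "c*d"] single_deriv_aux[of l i m "c*d"] add
      by (simp add: distrib_left poly_deriv_add poly_deriv_single mult_single lookup_add
         distrib_right single_add mult_ac add_ac)
  qed simp
  with add show ?case by (simp add: distrib_right distrib_left poly_deriv_add algebra_simps)
qed simp

lemma poly_deriv_sum: "poly_deriv i (sum f A) = (\<Sum>a\<in>A. poly_deriv i (f a))"
  by (induction A rule: infinite_finite_induct) (auto simp: poly_deriv_add)

lemma poly_deriv_sign: "poly_deriv i ((-1) ^ n * p) = (-1) ^ n * poly_deriv i p"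
proof -
  have "poly_deriv i ((-1) * p) = (-1) * poly_deriv i p" for p
    using poly_deriv_add[of i p "-p"] by (simp add: eq_neg_iff_add_eq_0 add.commute)
  then show ?thesis by (induction n) (auto simp: mult.assoc)
qed

lemma deriv_x_mult: "deriv_x i (f * g) = deriv_x i f * g + f * deriv_x i g"
proof (rule grassmann_eqI)
  fix J :: "nat set"
  have *: "poly_deriv i ((-1) ^ n * p * q) = (-1) ^ n * poly_deriv i p * q + (-1) ^ n * p * poly_deriv i q" for n p q
    using poly_deriv_sign[of i n "p * q"]
    by (simp only: poly_deriv_mult[of i p q] mult.assoc distrib_left)
  show "gcoeff (deriv_x i (f * g)) J = gcoeff (deriv_x i f * g + f * deriv_x i g) J"
    by (simp add: deriv_x.rep_eq gcoeff_times plus_grassmann.rep_eq poly_deriv_sum * sum.distrib)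
qed

lemma deriv_x_add: "deriv_x i (f + g) = deriv_x i f + deriv_x i g"
  by (rule grassmann_eqI) (simp add: deriv_x.rep_eq plus_grassmann.rep_eq poly_deriv_add)

lemma deriv_x_X: "deriv_x i (X j) = (if i = j then 1 else 0)"
  by (rule grassmann_eqI) (auto simp: deriv_x.rep_eq X_def gconst.rep_eq poly_deriv_single
   lookup_single one_grassmann.rep_eq zero_grassmann.rep_eq)

lemma deriv_x_eta: "deriv_x i (eta j) = 0"
proof -
  have "poly_deriv i 1 = 0" using poly_deriv_single[of i 0 1] by simp
  then show ?thesis
  by (intro grassmann_eqI) (auto simp: deriv_x.rep_eq eta.rep_eq zero_grassmann.rep_eq)
qed

lemma X_central: "X i * f = f * X i"
  unfolding X_def by (rule gconst_central)

lemma deriv_eta_X_times: "deriv_eta i (X j * f) = X j * deriv_eta i f"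
  unfolding X_def by (rule deriv_eta_gconst_times)

end

theory Submission
  imports Defs
begin

text \<open>
  The second part of \<open>F12\<close>, the Koszul differential, is a left odd derivation sending \<open>\<eta>\<^sub>i\<close> to
  \<open>x\<^sub>i\<close>, and so sends \<open>\<eta>(I)\<close> to \<open>\<Gamma>(I)\<close>. The first part only sees the powers of \<open>x\<^sub>2\<^sub>n\<^sub>+\<^sub>1\<close>: with
  \<open>m = 2(k-n-a)-1\<close>, it replaces \<open>b\<^sub>a x\<^sub>2\<^sub>n\<^sub>+\<^sub>1\<^sup>m\<close> by \<open>b\<^sub>a m x\<^sub>2\<^sub>n\<^sub>+\<^sub>1\<^sup>m\<^sup>-\<^sup>1 \<eta>\<^sub>2\<^sub>n\<^sub>+\<^sub>1\<close>, and \<open>b\<^sub>a m = b\<^sub>a\<^sub>+\<^sub>1\<close>.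
  All formulas hold with the sign \<open>-1\<close>, and homogeneity is read off from them.
\<close>

section \<open>The Koszul differential\<close>

definition koszul :: "nat set \<Rightarrow> super_poly \<Rightarrow> super_poly" where
  "koszul A f = (\<Sum>i\<in>A. X i * deriv_eta i f)"

lemma F12_koszul: "F12 n f = eta (2*n+1) * deriv_x (2*n+1) f - koszul {1..2*n} f"
  by (simp add: F12_def koszul_def)

lemma koszul_add: "koszul A (f + g) = koszul A f + koszul A g"
  by (simp add: koszul_def deriv_eta_add distrib_left sum.distrib)

lemma X_left_commute: "X i * (f * g) = f * (X i * g)"
  by (simp only: mult.assoc[symmetric] X_central[of i f])

lemma X_power_central: "X i ^ m * f = f * X i ^ m"
  by (rule power_commuting_commutes) (rule X_central)

lemma X_power_left_commute: "X i ^ m * (f * g) = f * (X i ^ m * g)"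
  by (simp only: mult.assoc[symmetric] X_power_central[of i m f])

lemma koszul_X_times: "koszul A (X j * f) = X j * koszul A f"
  unfolding koszul_def sum_distrib_left
  by (intro sum.cong refl) (simp add: deriv_eta_X_times X_left_commute[of j])

lemma koszul_X_power_times: "koszul A (X j ^ m * f) = X j ^ m * koszul A f"
  by (induction m) (simp_all add: koszul_X_times mult.assoc)

text \<open>Each left derivative obeys the odd Leibniz rule, and its inhomogeneous term survives
  only at the index \<open>x\<close>; the factors \<open>X i\<close> are central and pass through
  \<open>eta x\<close>.\<close>

lemma koszul_eta_times:
  assumes "finite A" "x \<in> A"
  shows "koszul A (eta x * f) = X x * f - eta x * koszul A f"
proof -
  have "koszul A (eta x * f)
      = (\<Sum>i\<in>A. (if i = x then X x * f else 0) - eta x * (X i * deriv_eta i f))"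
    unfolding koszul_def
  proof (intro sum.cong refl)
    fix i
    show "X i * deriv_eta i (eta x * f)
        = (if i = x then X x * f else 0) - eta x * (X i * deriv_eta i f)"
      by (simp only: deriv_eta_eta_times X_left_commute[of i "eta x"] right_diff_distrib)
        simp
  qed
  also have "\<dots> = X x * f - eta x * koszul A f"
    using assms by (simp add: sum_subtractf sum_distrib_left koszul_def)
  finally show ?thesis .
qed

lemma koszul_1: "koszul A 1 = 0"
  by (simp add: koszul_def)

text \<open>Working with lists lets the induction peel off the leftmost factor, each peeling
  contributing one sign. Distinctness ensures that \<open>remove1\<close> deletes exactly the factor
  at position \<open>j\<close>.\<close>

lemma koszul_eta_list:
  assumes "finite A" "set xs \<subseteq> A" "distinct xs"
  shows "koszul A (prod_list (map eta xs)) =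
    (\<Sum>j<length xs. (-1) ^ j * X (xs ! j) * prod_list (map eta (remove1 (xs ! j) xs)))"
  using assms(2,3)
proof (induction xs)
  case Nil
  then show ?case by (simp add: koszul_1)
next
  case (Cons x xs)
  let ?t = "\<lambda>xs j. (-1) ^ j * X (xs ! j) * prod_list (map eta (remove1 (xs ! j) xs))"
  \<comment> \<open>Passing the derivation over the leading \<open>eta x\<close> shifts the index by
    one and flips the sign.\<close>
  have step: "?t (x # xs) (Suc j) = - (eta x * ?t xs j)" if "j < length xs" for j
  proof -
    have "x \<noteq> xs ! j" using Cons.prems that by auto
    moreover have "(-1) ^ j * (eta x * g) = eta x * ((-1) ^ j * g)" for g :: super_poly
      by (cases "even j") simp_all
    ultimately show ?thesis
      by (simp add: mult.assoc X_left_commute[of _ "eta x"])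
  qed
  have "(\<Sum>j<length (x # xs). ?t (x # xs) j) = ?t (x # xs) 0 + (\<Sum>j<length xs. ?t (x # xs) (Suc j))"
    by (simp only: length_Cons sum.lessThan_Suc_shift)
  also have "\<dots> = X x * prod_list (map eta xs) - eta x * (\<Sum>j<length xs. ?t xs j)"
  proof -
    have "(\<Sum>j<length xs. ?t (x # xs) (Suc j)) = - (eta x * (\<Sum>j<length xs. ?t xs j))"
      unfolding sum_distrib_left sum_negf[symmetric] by (intro sum.cong refl step) simp
    then show ?thesis by simp
  qed
  also have "\<dots> = koszul A (prod_list (map eta (x # xs)))"
    using Cons by (simp add: koszul_eta_times[OF assms(1)])
  finally show ?case by simp
qed

lemma koszul_eta_prod:
  assumes "finite A" "I \<subseteq> A"
  shows "koszul A (eta_prod I) = Gamma I"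
proof -
  have "finite I" using assms finite_subset by blast
  then show ?thesis
    using koszul_eta_list[OF assms(1), of "sorted_list_of_set I"] assms(2)
    by (simp add: eta_prod_def Gamma_def sorted_list_of_set_remove)
qed


section \<open>Evaluation of \<open>F12\<close>\<close>

lemma F12_add: "F12 n (f + g) = F12 n f + F12 n g"
  by (simp add: F12_koszul koszul_add deriv_x_add distrib_left)

lemma F12_0: "F12 n 0 = 0"
  using F12_add[of n 0 0] by simp

lemma F12_sum: "F12 n (sum f A) = (\<Sum>a\<in>A. F12 n (f a))"
  by (induction A rule: infinite_finite_induct) (simp_all add: F12_0 F12_add)

lemma F12_minus: "F12 n (- f) = - F12 n f"
  using F12_add[of n f "- f"] by (simp add: F12_0 eq_neg_iff_add_eq_0 add.commute)

lemma F12_of_nat_times: "F12 n (of_nat m * f) = of_nat m * F12 n f"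
  by (induction m) (simp_all add: F12_0 F12_add distrib_right)

text \<open>Additivity already gives linearity over the integers, where the coefficients
  \<open>b_coeff\<close> live.\<close>

lemma F12_of_int_times: "F12 n (of_int c * f) = of_int c * F12 n f"
  by (cases c rule: int_cases2) (simp_all add: F12_of_nat_times F12_minus)

lemma deriv_x_1: "deriv_x i 1 = 0"
  using deriv_x_mult[of i 1 1] by simp

lemma deriv_x_X_power: "deriv_x i (X j ^ m) = (if i = j then of_nat m * X j ^ (m - 1) else 0)"
proof (induction m)
  case 0
  then show ?case by (simp add: deriv_x_1)
next
  case (Suc m)
  \<comment> \<open>For \<open>m = 0\<close> the exponent is truncated, but both sides
    vanish.\<close>
  have "X j * (of_nat m * X j ^ (m - 1)) = of_nat m * X j ^ m"
    unfolding X_left_commute[of j "of_nat m"] by (cases m) simp_all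
  with Suc show ?case
    by (simp add: deriv_x_mult deriv_x_X distrib_right)
qed

lemma deriv_x_eta_prod: "deriv_x i (eta_prod I) = 0"
proof -
  have "deriv_x i (prod_list (map eta xs)) = 0" for xs
    by (induction xs) (simp_all add: deriv_x_1 deriv_x_mult deriv_x_eta)
  then show ?thesis by (simp add: eta_prod_def)
qed

lemma eta_deriv_x_X_power_times:
  "eta k * deriv_x k (X j ^ m * f) = X j ^ m * (eta k * deriv_x k f) +
    (if j = k then of_nat m * (X j ^ (m - 1) * (eta k * f)) else 0)"
proof -
  have "eta k * (of_nat m * (X j ^ (m - 1) * f)) = of_nat m * (eta k * (X j ^ (m - 1) * f))"
    by (simp only: mult.assoc[symmetric] mult_of_nat_commute[of m "eta k"])
  moreover have "eta k * (X j ^ l * g) = X j ^ l * (eta k * g)" for l g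
    by (rule X_power_left_commute[symmetric])
  ultimately show ?thesis
    by (cases "j = k") (simp_all add: deriv_x_mult deriv_x_X_power distrib_left mult.assoc)
qed

text \<open>Used in two ways: for \<open>j = 1\<close> it pulls \<open>X 1 ^ d\<close> out of
  \<open>F12\<close>, and for \<open>j = 2*n+1\<close> the extra term yields the summands with
  \<open>eta (2*n+1)\<close>.\<close>

lemma F12_X_power_times: "F12 n (X j ^ m * f) = X j ^ m * F12 n f +
    (if j = 2*n+1 then of_nat m * (X j ^ (m - 1) * (eta j * f)) else 0)"
  unfolding F12_koszul eta_deriv_x_X_power_times koszul_X_power_times right_diff_distrib by simp

lemma F12_eta_prod: "I \<subseteq> {1..2*n} \<Longrightarrow> F12 n (eta_prod I) = - Gamma I"
  by (simp add: F12_koszul deriv_x_eta_prod koszul_eta_prod)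

section \<open>Coefficients and index sets of \<open>Delta\<close>\<close>

lemma b_coeff_Suc: "b_coeff n k (Suc a) = b_coeff n k a * (2 * (int k - int n - int a) - 1)"
  by (simp add: b_coeff_def)

text \<open>Since \<open>I\<close> lies in \<open>{1..n}\<close>, its mirror image lies in
  \<open>{n+1..2*n}\<close>. Thus \<open>eta (2*n+1)\<close> never occurs, and
  \<open>koszul {1..2*n}\<close> reaches every factor of the product.\<close>

lemma index_set_subset:
  assumes "n + 1 \<le> k" "k \<le> 2*n+1" "I \<in> index_sets n k a"
  shows "{1..2*n+1-k} \<union> I \<union> mirror n I \<subseteq> {1..2*n}"
  using assms by (auto simp: index_sets_def mirror_def; force)

text \<open>The three pieces are disjoint: the first lies below \<open>2*n+2-k\<close>,
  \<open>I\<close> lies between that bound and \<open>n\<close>, and the mirror image lies above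
  \<open>n\<close>.\<close>

lemma card_index_set:
  assumes "n + 1 \<le> k" "k \<le> 2*n+1" "I \<in> index_sets n k a"
  shows "card ({1..2*n+1-k} \<union> I \<union> mirror n I) = 2*n+1-k + 2*a"
proof -
  have I: "I \<subseteq> {2*n+2-k..n}" "card I = a" using assms(3) by (auto simp: index_sets_def)
  have fin: "finite I" using I(1) finite_subset by blast
  \<comment> \<open>Elements of \<open>I\<close> are at most \<open>n\<close>, so the subtraction is
    not truncated.\<close>
  have "inj_on (\<lambda>i. 2*n+1-i) I"
    using I(1) by (intro inj_onI) (auto dest!: subsetD)
  then have "card (mirror n I) = a" using I(2) by (simp add: mirror_def card_image)
  moreover have "{1..2*n+1-k} \<inter> I = {}" using I(1) by fastforce
  moreover have "({1..2*n+1-k} \<union> I) \<inter> mirror n I = {}"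
  proof -
    have "{1..2*n+1-k} \<union> I \<subseteq> {..n}" using I(1) assms(1) by auto
    moreover have "mirror n I \<subseteq> {n<..}" using I(1) by (force simp: mirror_def)
    ultimately show ?thesis by fastforce
  qed
  ultimately show ?thesis
    using fin I(2) by (simp add: card_Un_disjoint mirror_def)
qed

lemma F12_Delta_term:
  assumes "n + 1 \<le> k" "k \<le> 2*n+1" "a \<le> k - n - 1"
  shows "F12 n (of_int (b_coeff n k a) * X (2*n+1) ^ (2*(k-n-a)-1) *
      (\<Sum>I\<in>index_sets n k a. eta_prod ({1..2*n+1-k} \<union> I \<union> mirror n I)))
    = - (of_int (b_coeff n k a) * X (2*n+1) ^ (2*(k-n-a)-1) *
        (\<Sum>I\<in>index_sets n k a. Gamma ({1..2*n+1-k} \<union> I \<union> mirror n I)))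
      + of_int (b_coeff n k (a+1)) * X (2*n+1) ^ (2*(k-n-a)-2) * eta (2*n+1) *
        (\<Sum>I\<in>index_sets n k a. eta_prod ({1..2*n+1-k} \<union> I \<union> mirror n I))"
proof -
  let ?S = "\<Sum>I\<in>index_sets n k a. eta_prod ({1..2*n+1-k} \<union> I \<union> mirror n I)"
  let ?G = "\<Sum>I\<in>index_sets n k a. Gamma ({1..2*n+1-k} \<union> I \<union> mirror n I)"
  define m where "m = 2*(k-n-a)-1"
  \<comment> \<open>The bound on \<open>a\<close> gives \<open>k-n-a \<ge> 1\<close>, so nothing is
    truncated and the exponent \<open>m\<close> is exactly the last factor of
    \<open>b_coeff n k (a+1)\<close>.\<close>
  have "int m = 2 * (int k - int n - int a) - 1" using assms by (simp add: m_def)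
  then have b: "of_int (b_coeff n k (a+1)) = of_int (b_coeff n k a) * (of_nat m :: super_poly)"
    by (metis Suc_eq_plus1 b_coeff_Suc of_int_mult of_int_of_nat_eq)
  have "F12 n ?S = (\<Sum>I\<in>index_sets n k a. - Gamma ({1..2*n+1-k} \<union> I \<union> mirror n I))"
    unfolding F12_sum
    by (intro sum.cong refl F12_eta_prod index_set_subset[OF assms(1,2)])
  then have "F12 n ?S = - ?G" by (simp add: sum_negf)
  moreover have "2*(k-n-a)-2 = m - 1" by (simp add: m_def)
  ultimately show ?thesis
    unfolding m_def[symmetric] b
    by (simp add: mult.assoc F12_of_int_times F12_X_power_times right_diff_distrib)
qed

text \<open>The range starts at \<open>k = n+1\<close>, so the middle case is a specialization; the
  degree count for all \<open>k > n\<close> also rests on this formula.\<close>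

lemma F12_Delta:
  assumes "n + 1 \<le> k" "k \<le> 2*n+1"
  shows "F12 n (Delta n k) =
    - ((\<Sum>a=0..k-n-1. of_int (b_coeff n k a) * X (2*n+1) ^ (2*(k-n-a)-1) *
        (\<Sum>I\<in>index_sets n k a. Gamma ({1..2*n+1-k} \<union> I \<union> mirror n I)))
     - (\<Sum>a=0..k-n-1. of_int (b_coeff n k (a+1)) * X (2*n+1) ^ (2*(k-n-a)-2) * eta (2*n+1) *
        (\<Sum>I\<in>index_sets n k a. eta_prod ({1..2*n+1-k} \<union> I \<union> mirror n I))))"
proof -
  have "F12 n (Delta n k) = (\<Sum>a=0..k-n-1.
    - (of_int (b_coeff n k a) * X (2*n+1) ^ (2*(k-n-a)-1) *
        (\<Sum>I\<in>index_sets n k a. Gamma ({1..2*n+1-k} \<union> I \<union> mirror n I)))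
      + of_int (b_coeff n k (a+1)) * X (2*n+1) ^ (2*(k-n-a)-2) * eta (2*n+1) *
        (\<Sum>I\<in>index_sets n k a. eta_prod ({1..2*n+1-k} \<union> I \<union> mirror n I)))"
    unfolding Delta_def F12_sum
    by (intro sum.cong refl F12_Delta_term assms) simp
  then show ?thesis by (simp only: sum.distrib sum_negf) simp
qed


section \<open>Homogeneous components\<close>

text \<open>Coefficients at infinite sets vanish, so only finite \<open>J\<close> have to be
  checked.\<close>

lemma S_homogI:
  assumes "\<And>J e. e \<in> Poly_Mapping.keys (gcoeff f J) \<Longrightarrow> finite J \<Longrightarrow>
    J \<subseteq> {1..2*n+1} \<and> Poly_Mapping.keys e \<subseteq> {1..2*n+1} \<and>
     (\<Sum>i\<in>{1..2*n+1}. Poly_Mapping.lookup e i) + card J = m"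
  shows "f \<in> S_homog n m"
proof -
  have "finite J" if "e \<in> Poly_Mapping.keys (gcoeff f J)" for J e
    using that gcoeff_infinite[of J f] by fastforce
  then show ?thesis unfolding S_homog_def using assms by blast
qed

lemma S_homogD:
  assumes "f \<in> S_homog n m" "e \<in> Poly_Mapping.keys (gcoeff f J)"
  shows "J \<subseteq> {1..2*n+1}" "Poly_Mapping.keys e \<subseteq> {1..2*n+1}"
    "(\<Sum>i\<in>{1..2*n+1}. Poly_Mapping.lookup e i) + card J = m"
  using assms by (auto simp: S_homog_def)

lemma S_homog_0: "0 \<in> S_homog n m"
  by (simp add: S_homog_def zero_grassmann.rep_eq)

lemma S_homog_minus: "f \<in> S_homog n m \<Longrightarrow> - f \<in> S_homog n m"
  by (simp add: S_homog_def uminus_grassmann.rep_eq)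

lemma S_homog_add: "f \<in> S_homog n m \<Longrightarrow> g \<in> S_homog n m \<Longrightarrow> f + g \<in> S_homog n m"
proof (rule S_homogI)
  fix J e assume f: "f \<in> S_homog n m" and g: "g \<in> S_homog n m"
    and "e \<in> Poly_Mapping.keys (gcoeff (f + g) J)"
  then have "e \<in> Poly_Mapping.keys (gcoeff f J) \<or> e \<in> Poly_Mapping.keys (gcoeff g J)"
    using keys_add[of "gcoeff f J" "gcoeff g J"] by (auto simp: plus_grassmann.rep_eq)
  then show "J \<subseteq> {1..2*n+1} \<and> Poly_Mapping.keys e \<subseteq> {1..2*n+1} \<and>
      (\<Sum>i\<in>{1..2*n+1}. Poly_Mapping.lookup e i) + card J = m"
    using S_homogD[OF f] S_homogD[OF g] by metis
qed

lemma S_homog_diff: "f \<in> S_homog n m \<Longrightarrow> g \<in> S_homog n m \<Longrightarrow> f - g \<in> S_homog n m"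
  using S_homog_add[OF _ S_homog_minus, of f n m g] by simp

lemma S_homog_sum: "(\<And>a. a \<in> A \<Longrightarrow> f a \<in> S_homog n m) \<Longrightarrow> sum f A \<in> S_homog n m"
  by (induction A rule: infinite_finite_induct) (simp_all add: S_homog_0 S_homog_add)

text \<open>A monomial of the product at \<open>J\<close> comes from a splitting of \<open>J\<close>
  into \<open>A\<close> and \<open>J - A\<close> and of its exponent into \<open>u + v\<close>;
  cardinalities and exponent sums both add.\<close>

lemma S_homog_mult:
  assumes "f \<in> S_homog n m" "g \<in> S_homog n l"
  shows "f * g \<in> S_homog n (m + l)"
proof (rule S_homogI)
  fix J e assume e: "e \<in> Poly_Mapping.keys (gcoeff (f * g) J)" and J: "finite J"
  have "Poly_Mapping.keys (gcoeff (f * g) J) \<subseteq>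
      (\<Union>A\<in>Pow J. Poly_Mapping.keys ((-1) ^ inversions A (J - A) * gcoeff f A * gcoeff g (J - A)))"
    unfolding gcoeff_times by (rule keys_sum)
  then obtain A where A: "A \<subseteq> J"
    and "e \<in> Poly_Mapping.keys ((-1) ^ inversions A (J - A) * gcoeff f A * gcoeff g (J - A))"
    using e by blast
  \<comment> \<open>A sign does not change the support of a polynomial.\<close>
  then have "e \<in> Poly_Mapping.keys (gcoeff f A * gcoeff g (J - A))"
    by (cases "even (inversions A (J - A))") simp_all
  then obtain u v where uv: "e = u + v" "u \<in> Poly_Mapping.keys (gcoeff f A)"
      "v \<in> Poly_Mapping.keys (gcoeff g (J - A))"
    using keys_mult by blast
  note f = S_homogD[OF assms(1) uv(2)] and g = S_homogD[OF assms(2) uv(3)]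
  have "card J = card A + card (J - A)"
    using A J by (metis card_Diff_subset card_mono finite_subset le_add_diff_inverse)
  moreover have "Poly_Mapping.keys e \<subseteq> {1..2*n+1}"
    using f(2) g(2) keys_add[of u v] uv(1) by blast
  moreover have "J \<subseteq> {1..2*n+1}"
    using f(1) g(1) by blast
  moreover have "(\<Sum>i\<in>{1..2*n+1}. Poly_Mapping.lookup e i) =
      (\<Sum>i\<in>{1..2*n+1}. Poly_Mapping.lookup u i) + (\<Sum>i\<in>{1..2*n+1}. Poly_Mapping.lookup v i)"
    unfolding uv(1) lookup_add by (rule sum.distrib)
  ultimately show "J \<subseteq> {1..2*n+1} \<and> Poly_Mapping.keys e \<subseteq> {1..2*n+1} \<and>
      (\<Sum>i\<in>{1..2*n+1}. Poly_Mapping.lookup e i) + card J = m + l"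
    using f(3) g(3) by linarith
qed

section \<open>Degrees of constants, generators and their products\<close>

lemma S_homog_1: "1 \<in> S_homog n 0"
  by (rule S_homogI) (auto simp: one_grassmann.rep_eq split: if_splits)

lemma S_homog_of_int: "of_int c \<in> S_homog n 0"
proof -
  have "of_nat m \<in> S_homog n 0" for m
    by (induction m) (simp_all add: S_homog_0 S_homog_1 S_homog_add)
  then show ?thesis by (cases c rule: int_cases2) (simp_all add: S_homog_minus)
qed

lemma S_homog_X: "i \<in> {1..2*n+1} \<Longrightarrow> X i \<in> S_homog n 1"
proof (rule S_homogI)
  fix J e assume i: "i \<in> {1..2*n+1}" and e: "e \<in> Poly_Mapping.keys (gcoeff (X i) J)"
  from e have "J = {}" "e = Poly_Mapping.single i 1"
    by (simp_all add: X_def gconst.rep_eq split: if_splits)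
  moreover have "(\<Sum>j\<in>{1..2*n+1}. Poly_Mapping.lookup (Poly_Mapping.single i 1) j)
      = (\<Sum>j\<in>{1..2*n+1}. if i = j then 1 else 0 :: nat)"
    by (intro sum.cong refl) (simp only: lookup_single when_def)
  moreover have "\<dots> = 1" using i by (simp only: sum.delta' finite_atLeastAtMost if_True)
  ultimately show "J \<subseteq> {1..2*n+1} \<and> Poly_Mapping.keys e \<subseteq> {1..2*n+1} \<and>
      (\<Sum>i\<in>{1..2*n+1}. Poly_Mapping.lookup e i) + card J = 1"
    using i by (metis add.right_neutral card.empty empty_subsetI insert_subset keys_single one_neq_zero)
qed

lemma S_homog_eta: "i \<in> {1..2*n+1} \<Longrightarrow> eta i \<in> S_homog n 1"
proof (rule S_homogI)
  fix J and e :: "nat \<Rightarrow>\<^sub>0 nat"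
  assume i: "i \<in> {1..2*n+1}" and e: "e \<in> Poly_Mapping.keys (gcoeff (eta i) J)"
  from e have "J = {i}" "e = 0"
    by (simp_all add: eta.rep_eq split: if_splits)
  with i show "J \<subseteq> {1..2*n+1} \<and> Poly_Mapping.keys e \<subseteq> {1..2*n+1} \<and>
      (\<Sum>i\<in>{1..2*n+1}. Poly_Mapping.lookup e i) + card J = 1"
    by simp
qed

lemma S_homog_X_power: "i \<in> {1..2*n+1} \<Longrightarrow> X i ^ m \<in> S_homog n m"
proof (induction m)
  case (Suc m)
  then show ?case using S_homog_mult[OF S_homog_X, of i n "X i ^ m" m] by simp
qed (simp add: S_homog_1)

lemma S_homog_eta_prod:
  assumes "I \<subseteq> {1..2*n+1}"
  shows "eta_prod I \<in> S_homog n (card I)"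
proof -
  have "prod_list (map eta xs) \<in> S_homog n (length xs)" if "set xs \<subseteq> {1..2*n+1}" for xs
    using that
  proof (induction xs)
    case (Cons x xs)
    then show ?case
      using S_homog_mult[OF S_homog_eta, of x n "prod_list (map eta xs)" "length xs"] by simp
  qed (simp add: S_homog_1)
  from this[of "sorted_list_of_set I"] show ?thesis
    using assms finite_subset[OF assms] by (simp add: eta_prod_def)
qed

text \<open>Each summand trades one odd generator for an even one, which preserves the total
  degree.\<close>

lemma S_homog_Gamma:
  assumes "I \<subseteq> {1..2*n+1}"
  shows "Gamma I \<in> S_homog n (card I)"
  unfolding Gamma_def
proof (rule S_homog_sum)
  fix j assume "j \<in> {..<card I}"
  let ?x = "sorted_list_of_set I ! j"
  have fin: "finite I" using assms finite_subset by blast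
  then have x: "?x \<in> I"
    using \<open>j \<in> _\<close> by (metis lessThan_iff length_sorted_list_of_set nth_mem set_sorted_list_of_set)
  have "(-1) ^ j \<in> S_homog n 0"
    using S_homog_of_int[of "(-1) ^ j" n] by simp
  moreover have "X ?x \<in> S_homog n 1"
    using x assms by (intro S_homog_X) auto
  moreover have "eta_prod (I - {?x}) \<in> S_homog n (card (I - {?x}))"
    using assms by (intro S_homog_eta_prod) auto
  ultimately have "(-1) ^ j * X ?x * eta_prod (I - {?x}) \<in> S_homog n (0 + 1 + card (I - {?x}))"
    by (intro S_homog_mult)
  then show "(-1) ^ j * X ?x * eta_prod (I - {?x}) \<in> S_homog n (card I)"
    using card_Suc_Diff1[OF fin x] by simp
qed

text \<open>Degrees are counted in the explicit formula: a product in \<open>?K I\<close> has degree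
  \<open>2*n+1-k+2*a\<close>, and the accompanying powers of \<open>X (2*n+1)\<close>, together with
  \<open>eta (2*n+1)\<close> in the second sum, bring it to \<open>k\<close>.\<close>

lemma S_homog_F12_Delta:
  assumes k: "n + 1 \<le> k" "k \<le> 2*n+1"
  shows "F12 n (Delta n k) \<in> S_homog n k"
  unfolding F12_Delta[OF assms]
proof (intro S_homog_minus S_homog_diff S_homog_sum)
  fix a assume a: "a \<in> {0..k-n-1}"
  let ?K = "\<lambda>I. {1..2*n+1-k} \<union> I \<union> mirror n I"
  have sub: "?K I \<subseteq> {1..2*n+1}" if "I \<in> index_sets n k a" for I
    using index_set_subset[OF k that] by fastforce
  have "(\<Sum>I\<in>index_sets n k a. Gamma (?K I)) \<in> S_homog n (2*n+1-k+2*a)"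
    using S_homog_Gamma[OF sub] card_index_set[OF k] by (intro S_homog_sum) metis
  then have "of_int (b_coeff n k a) * X (2*n+1) ^ (2*(k-n-a)-1) *
      (\<Sum>I\<in>index_sets n k a. Gamma (?K I)) \<in> S_homog n (0 + (2*(k-n-a)-1) + (2*n+1-k+2*a))"
    by (intro S_homog_mult S_homog_of_int S_homog_X_power) auto
  \<comment> \<open>The terms in \<open>a\<close> and \<open>n\<close> cancel, since
    \<open>a \<le> k-n-1\<close> and \<open>k \<le> 2*n+1\<close> rule out truncation.\<close>
  moreover have "0 + (2*(k-n-a)-1) + (2*n+1-k+2*a) = k" using a k by auto
  ultimately show "of_int (b_coeff n k a) * X (2*n+1) ^ (2*(k-n-a)-1) *
      (\<Sum>I\<in>index_sets n k a. Gamma (?K I)) \<in> S_homog n k"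
    by (simp only:)
  have "(\<Sum>I\<in>index_sets n k a. eta_prod (?K I)) \<in> S_homog n (2*n+1-k+2*a)"
    using S_homog_eta_prod[OF sub] card_index_set[OF k] by (intro S_homog_sum) metis
  then have "of_int (b_coeff n k (a+1)) * X (2*n+1) ^ (2*(k-n-a)-2) * eta (2*n+1) *
      (\<Sum>I\<in>index_sets n k a. eta_prod (?K I)) \<in> S_homog n (0 + (2*(k-n-a)-2) + 1 + (2*n+1-k+2*a))"
    by (intro S_homog_mult S_homog_of_int S_homog_X_power S_homog_eta) auto
  moreover have "0 + (2*(k-n-a)-2) + 1 + (2*n+1-k+2*a) = k" using a k by auto
  ultimately show "of_int (b_coeff n k (a+1)) * X (2*n+1) ^ (2*(k-n-a)-2) * eta (2*n+1) *
      (\<Sum>I\<in>index_sets n k a. eta_prod (?K I)) \<in> S_homog n k"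
    by (simp only:)
qed


section \<open>The elements \<open>p\<^sub>d\<^sub>,\<^sub>k\<close>\<close>

text \<open>For \<open>n \<ge> 1\<close> the index \<open>1\<close> differs from
  \<open>2*n+1\<close>, so \<open>F12\<close> is linear over powers of \<open>X 1\<close>.\<close>

lemma p_elem_eq: "n \<ge> 1 \<Longrightarrow> p_elem n d k = X 1 ^ d * F12 n (s_elem n k)"
  by (simp add: p_elem_def F12_X_power_times)

lemma F12_s_elem_low: "k \<le> n \<Longrightarrow> F12 n (s_elem n k) = - Gamma {1..k}"
  by (auto simp: s_elem_def intro!: F12_eta_prod)

text \<open>At \<open>k = n+1\<close> only \<open>a = 0\<close> remains, the interval for
  \<open>I\<close> is empty, and \<open>b_coeff\<close> equals 1 at both 0 and 1.\<close>

lemma F12_s_elem_middle: "F12 n (s_elem n (n+1)) =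
    - (X (2*n+1) * Gamma {1..n} - eta (2*n+1) * eta_prod {1..n})"
proof -
  have "index_sets n (n+1) 0 = {{}}" by (auto simp: index_sets_def card_eq_0_iff dest: finite_subset)
  then show ?thesis
    using F12_Delta[of n "n+1"] by (simp add: s_elem_def b_coeff_def mirror_def)
qed

lemma p_elem_homog:
  assumes "n \<ge> 1" "k \<le> 2*n+1"
  shows "p_elem n d k \<in> S_homog n (d + k)"
proof -
  have "F12 n (s_elem n k) \<in> S_homog n k"
  proof (cases "k \<le> n")
    case True
    then show ?thesis
      using S_homog_Gamma[of "{1..k}" n] by (simp add: F12_s_elem_low S_homog_minus)
  next
    case False
    then show ?thesis using S_homog_F12_Delta assms(2) by (simp add: s_elem_def)
  qed
  then show ?thesis
    unfolding p_elem_eq[OF assms(1)] by (intro S_homog_mult S_homog_X_power) auto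
qed

theorem lemmaA2:
  fixes n d :: nat
  assumes "n \<ge> 1"
  shows "(\<forall>k\<in>{1..2*n+1}. p_elem n d k \<in> S_homog n (d + k)) \<and>
    (\<exists>\<epsilon>\<in>{1, -1 :: super_poly}.
      (\<forall>k\<in>{1..n}. p_elem n d k = \<epsilon> * (X 1 ^ d * Gamma {1..k})) \<and>
      p_elem n d (n+1) =
        \<epsilon> * (X 1 ^ d * (X (2*n+1) * Gamma {1..n} - eta (2*n+1) * eta_prod {1..n})) \<and>
      (\<forall>k\<in>{n+2..2*n+1}. p_elem n d k = \<epsilon> *
        (X 1 ^ d * (\<Sum>a=0..k-n-1. of_int (b_coeff n k a) * X (2*n+1) ^ (2*(k-n-a)-1) *
            (\<Sum>I\<in>index_sets n k a. Gamma ({1..2*n+1-k} \<union> I \<union> mirror n I)))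
         - X 1 ^ d * (\<Sum>a=0..k-n-1. of_int (b_coeff n k (a+1)) * X (2*n+1) ^ (2*(k-n-a)-2) *
            eta (2*n+1) *
            (\<Sum>I\<in>index_sets n k a. eta_prod ({1..2*n+1-k} \<union> I \<union> mirror n I))))))"
proof (intro conjI)
  show "\<forall>k\<in>{1..2*n+1}. p_elem n d k \<in> S_homog n (d + k)"
    using p_elem_homog[OF assms] by simp
next
  note p = p_elem_eq[OF assms]
  show "\<exists>\<epsilon>\<in>{1, -1 :: super_poly}.
      (\<forall>k\<in>{1..n}. p_elem n d k = \<epsilon> * (X 1 ^ d * Gamma {1..k})) \<and>
      p_elem n d (n+1) =
        \<epsilon> * (X 1 ^ d * (X (2*n+1) * Gamma {1..n} - eta (2*n+1) * eta_prod {1..n})) \<and>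
      (\<forall>k\<in>{n+2..2*n+1}. p_elem n d k = \<epsilon> *
        (X 1 ^ d * (\<Sum>a=0..k-n-1. of_int (b_coeff n k a) * X (2*n+1) ^ (2*(k-n-a)-1) *
            (\<Sum>I\<in>index_sets n k a. Gamma ({1..2*n+1-k} \<union> I \<union> mirror n I)))
         - X 1 ^ d * (\<Sum>a=0..k-n-1. of_int (b_coeff n k (a+1)) * X (2*n+1) ^ (2*(k-n-a)-2) *
            eta (2*n+1) *
            (\<Sum>I\<in>index_sets n k a. eta_prod ({1..2*n+1-k} \<union> I \<union> mirror n I)))))"
  proof (intro bexI[of _ "-1"] conjI ballI)
    fix k assume "k \<in> {1..n}"
    then show "p_elem n d k = -1 * (X 1 ^ d * Gamma {1..k})"
      unfolding p by (simp add: F12_s_elem_low)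
  next
    show "p_elem n d (n+1) =
        -1 * (X 1 ^ d * (X (2*n+1) * Gamma {1..n} - eta (2*n+1) * eta_prod {1..n}))"
      unfolding p F12_s_elem_middle by (simp only: mult_minus_right mult_minus_left mult_1_left)
  next
    fix k assume "k \<in> {n+2..2*n+1}"
    then have k: "n + 1 \<le> k" "k \<le> 2*n+1" by simp_all
    then have s: "s_elem n k = Delta n k" by (simp add: s_elem_def)
    show "p_elem n d k = -1 *
        (X 1 ^ d * (\<Sum>a=0..k-n-1. of_int (b_coeff n k a) * X (2*n+1) ^ (2*(k-n-a)-1) *
            (\<Sum>I\<in>index_sets n k a. Gamma ({1..2*n+1-k} \<union> I \<union> mirror n I)))
         - X 1 ^ d * (\<Sum>a=0..k-n-1. of_int (b_coeff n k (a+1)) * X (2*n+1) ^ (2*(k-n-a)-2) *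
            eta (2*n+1) *
            (\<Sum>I\<in>index_sets n k a. eta_prod ({1..2*n+1-k} \<union> I \<union> mirror n I))))"
      unfolding p s F12_Delta[OF k]
      by (simp only: mult_minus_right mult_minus_left mult_1_left right_diff_distrib[of "X 1 ^ d"])
  qed simp
qed

end
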